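(* Let $k$ be a perfect field of characteristic $p>0$, and let $E\in k[t,y]$ be irreducible and separable in $k(t)[y]$, with $d=\deg_y E\ge 1$ and $h=\deg_t E$. Assume $E$ has a root $f\in k[[t]]$ with $E_y(t,f)\neq 0$, where $E_y=\partial E/\partial y$. Let $L=k(t)[y]/(E)$ and let $S_0,\dots,S_{p-1}:L\to L$ be the section operators defined below. Then for every $P\in k[t,y]$ with $\deg_t P<h$ and $\deg_y P<d$ and every $0\le r<p$, there exists a unique polynomial $Q\in k[t,y]$ with $\deg_t Q<h$ and $\deg_y Q<d$ such that $$S_r\!\left(\frac{P}{E_y}\right)\equiv \frac{Q}{E_y}\pmod E,$$ i.e. $S_r(P/E_y)=Q/E_y$ in $L$.
   Context: Since $E$ is irreducible and separable, $L=k(t)[y]/(E)$ is a field and $E_y$ is invertible in $L$. The Frobenius map $\mathsf F:z\mapsto z^p$ is a ring isomorphism from $L[t^{1/p}]$ onto $L$, and every element of $L[t^{1/p}]$ can be written uniquely as $\sum_{r=0}^{p-1}t^{r/p}z_r$ with $z_r\in L$. The section operators $S_r:L\to L$ ($0\le r<p$) are defined by $\mathsf F^{-1}(z)=\sum_{r=0}^{p-1}t^{r/p}S_r(z)$ for $z\in L$. (Via the embedding $L\to k((t))$, $y\mapsto f$, these agree with the local sections $S_r\big(\sum_n g_nt^n\big)=\sum_n g_{pn+r}^{1/p}t^n$.) *)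

theory Defs
  imports "HOL-Algebra.Algebraic_Closure_Type"
begin

text \<open>
  Bivariate polynomials in \<open>k[t,y]\<close> have type \<open>'k poly poly\<close>: the outer variable is \<open>y\<close>, the
  inner one is \<open>t\<close>. Accordingly \<open>k(t)\<close> is \<open>'k poly fract\<close>, \<open>k(t)[y]\<close> is \<open>'k poly fract poly\<close>,
  \<open>fract_poly\<close> is the inclusion of \<open>k[t,y]\<close> in \<open>k(t)[y]\<close>, \<open>pderiv\<close> is the derivative in \<open>y\<close> and
  \<open>Polynomial.degree\<close> the degree in \<open>y\<close>.
\<close>

definition perfect_field :: "'k::field itself \<Rightarrow> bool" where
  "perfect_field _ \<longleftrightarrow> CHAR('k) = 0 \<or> surj (\<lambda>x::'k. x ^ CHAR('k))"

definition separable_poly :: "'a::field poly \<Rightarrow> bool" where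
  "separable_poly q \<longleftrightarrow> coprime q (pderiv q)"

definition deg_t :: "'k::field poly poly \<Rightarrow> nat" where
  "deg_t P = (MAX i\<in>{..Polynomial.degree P}. Polynomial.degree (Polynomial.coeff P i))"

text \<open>
  The zero polynomial has degree \<open>-\<infinity>\<close> here, so that it satisfies \<open>deg_t P < h\<close> even if \<open>h = 0\<close>.
\<close>

definition deg_t_less :: "'k::field poly poly \<Rightarrow> nat \<Rightarrow> bool" where
  "deg_t_less P h \<longleftrightarrow> P = 0 \<or> deg_t P < h"

definition deg_y_less :: "'k::field poly poly \<Rightarrow> nat \<Rightarrow> bool" where
  "deg_y_less P d \<longleftrightarrow> P = 0 \<or> Polynomial.degree P < d"

definition eval_y :: "'k::field poly poly \<Rightarrow> 'k fps \<Rightarrow> 'k fps" where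
  "eval_y P f = poly (map_poly fps_of_poly P) f"

subsection \<open>The field \<open>L = k(t)[y]/(E)\<close>\<close>

definition kt_y :: "'k::field poly fract poly ring" where
  "kt_y = ring_of_type_algebra"

definition L_ring :: "'k::field poly poly \<Rightarrow> 'k poly fract poly set ring" where
  "L_ring E = kt_y Quot (PIdl\<^bsub>kt_y\<^esub> (fract_poly E))"

definition L_class :: "'k::field poly poly \<Rightarrow> 'k poly poly \<Rightarrow> 'k poly fract poly set" where
  "L_class E P = PIdl\<^bsub>kt_y\<^esub> (fract_poly E) +>\<^bsub>kt_y\<^esub> fract_poly P"

definition L_over_Ey :: "'k::field poly poly \<Rightarrow> 'k poly poly \<Rightarrow> 'k poly fract poly set" where
  "L_over_Ey E P = L_class E P \<otimes>\<^bsub>L_ring E\<^esub> inv\<^bsub>L_ring E\<^esub> (L_class E (pderiv E))"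

subsection \<open>The extension \<open>L[t^(1/p)] = L[X]/(X^p - t)\<close>\<close>

definition L_poly :: "'k::field poly poly \<Rightarrow> 'k poly fract poly set list ring" where
  "L_poly E = (carrier (L_ring E)) [X]\<^bsub>L_ring E\<^esub>"

definition L_root_poly :: "'k::field poly poly \<Rightarrow> nat \<Rightarrow> 'k poly fract poly set list" where
  "L_root_poly E p =
     (X\<^bsub>L_ring E\<^esub> [^]\<^bsub>L_poly E\<^esub> p) \<ominus>\<^bsub>L_poly E\<^esub> ring.poly_of_const (L_ring E) (L_class E [:[:0, 1:]:])"

definition Lt_ring :: "'k::field poly poly \<Rightarrow> nat \<Rightarrow> 'k poly fract poly set list set ring" where
  "Lt_ring E p = Rupt\<^bsub>L_ring E\<^esub> (carrier (L_ring E)) (L_root_poly E p)"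

definition Lt_class :: "'k::field poly poly \<Rightarrow> nat \<Rightarrow> 'k poly fract poly set list
    \<Rightarrow> 'k poly fract poly set list set" where
  "Lt_class E p q = PIdl\<^bsub>L_poly E\<^esub> (L_root_poly E p) +>\<^bsub>L_poly E\<^esub> q"

definition Lt_embed :: "'k::field poly poly \<Rightarrow> nat \<Rightarrow> 'k poly fract poly set
    \<Rightarrow> 'k poly fract poly set list set" where
  "Lt_embed E p z = Lt_class E p (ring.poly_of_const (L_ring E) z)"

definition t_root :: "'k::field poly poly \<Rightarrow> nat \<Rightarrow> 'k poly fract poly set list set" where
  "t_root E p = Lt_class E p X\<^bsub>L_ring E\<^esub>"

subsection \<open>Frobenius and the section operators\<close>

text \<open>
  The \<open>p\<close>-th power of an element of \<open>L[t^(1/p)]\<close> lies in the image of \<open>L\<close>; the Frobenius map takes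
  it as an element of \<open>L\<close> itself.
\<close>

definition frob :: "'k::field poly poly \<Rightarrow> nat \<Rightarrow> 'k poly fract poly set list set
    \<Rightarrow> 'k poly fract poly set" where
  "frob E p w = (THE z. z \<in> carrier (L_ring E) \<and> Lt_embed E p z = w [^]\<^bsub>Lt_ring E p\<^esub> p)"

definition frob_inv :: "'k::field poly poly \<Rightarrow> nat \<Rightarrow> 'k poly fract poly set
    \<Rightarrow> 'k poly fract poly set list set" where
  "frob_inv E p = inv_into (carrier (Lt_ring E p)) (frob E p)"

definition t_root_coords :: "'k::field poly poly \<Rightarrow> nat \<Rightarrow> 'k poly fract poly set list set
    \<Rightarrow> nat \<Rightarrow> 'k poly fract poly set" where
  "t_root_coords E p w = (THE c. c \<in> {..<p} \<rightarrow>\<^sub>E carrier (L_ring E) \<and>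
     w = (\<Oplus>\<^bsub>Lt_ring E p\<^esub>i\<in>{..<p}.
            (t_root E p [^]\<^bsub>Lt_ring E p\<^esub> i) \<otimes>\<^bsub>Lt_ring E p\<^esub> Lt_embed E p (c i)))"

definition section_op :: "'k::field poly poly \<Rightarrow> nat \<Rightarrow> nat \<Rightarrow> 'k poly fract poly set
    \<Rightarrow> 'k poly fract poly set" where
  "section_op E p r z = t_root_coords E p (frob_inv E p z) r"

end

theory Submission
  imports Defs
begin

text \<open>
  The polynomial \<open>Q\<close> is explicit: with \<open>G = P E\<^bsup>p-1\<^esup> = \<Sum> g\<^sub>i\<^sub>j t\<^sup>i y\<^sup>j\<close>, it collects the \<open>p\<close>-th roots
  of the coefficients \<open>g\<^sub>i\<^sub>j\<close> with \<open>i \<equiv> r\<close> and \<open>j \<equiv> p - 1\<close> modulo \<open>p\<close>, which gives the degree bounds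
  at once. The part of \<open>G\<close> with \<open>j \<equiv> p - 1\<close> is \<open>y\<^bsup>p-1\<^esup> \<Sum>\<^sub>r t\<^sup>r Q\<^sub>r\<^sup>p\<close>, and \<open>\<partial>\<^sub>y\<^bsup>p-1\<^esup>\<close> kills everything
  else, so \<open>\<partial>\<^sub>y\<^bsup>p-1\<^esup> G = (p-1)! \<Sum>\<^sub>r t\<^sup>r Q\<^sub>r\<^sup>p\<close>. By the Leibniz rule the same derivative is congruent
  to \<open>(p-1)! P E\<^sub>y\<^bsup>p-1\<^esup>\<close> modulo \<open>E\<close>. Dividing by \<open>E\<^sub>y\<^sup>p\<close> yields \<open>P/E\<^sub>y = \<Sum>\<^sub>r t\<^sup>r (Q\<^sub>r/E\<^sub>y)\<^sup>p\<close> in \<open>L\<close>.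

  That the sections of \<open>P/E\<^sub>y\<close> can be read off from this identity means that \<open>1, t, \<dots>, t\<^bsup>p-1\<^esup>\<close> are
  linearly independent over \<open>L\<^sup>p\<close>. The root \<open>f\<close> embeds \<open>L\<close> in the Laurent series, where the terms of
  \<open>\<Sum>\<^sub>r t\<^sup>r z\<^sub>r\<^sup>p\<close> have orders that are distinct modulo \<open>p\<close> and hence cannot cancel.
\<close>

section \<open>Sections of polynomials\<close>

text \<open>One derivative turns \<open>P * E ^ Suc n\<close> into two multiples of
  \<open>E ^ n\<close>, with cofactors \<open>pderiv P * E\<close> and
  \<open>Suc n * P * pderiv E\<close>. The induction hypothesis covers both, since \<open>P\<close>
  is arbitrary; for the first cofactor its main term is itself divisible by
  \<open>E\<close>.\<close>

lemma dvd_higher_pderiv_mult_power: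
  fixes P E :: "'a::idom poly"
  shows "E dvd (pderiv ^^ n) (P * E ^ n) - of_nat (fact n) * P * pderiv E ^ n"
proof (induction n arbitrary: P)
  case (Suc n)
  have eq: "pderiv (P * E ^ Suc n) =
      (pderiv P * E) * E ^ n + (of_nat (Suc n) * P * pderiv E) * E ^ n"
    by (simp only: pderiv_mult pderiv_power_Suc)
      (simp add: algebra_simps smult_add_left of_nat_poly)
  have "(pderiv ^^ Suc n) (P * E ^ Suc n) =
      (pderiv ^^ n) ((pderiv P * E) * E ^ n) +
      (pderiv ^^ n) ((of_nat (Suc n) * P * pderiv E) * E ^ n)"
    by (simp only: funpow_Suc_right o_apply eq higher_pderiv_add)
  moreover have "of_nat (fact n) * (of_nat (Suc n) * P * pderiv E) * pderiv E ^ n =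
      of_nat (fact (Suc n)) * P * pderiv E ^ Suc n"
    by (simp add: algebra_simps)
  ultimately have "(pderiv ^^ Suc n) (P * E ^ Suc n) - of_nat (fact (Suc n)) * P * pderiv E ^ Suc n =
      (pderiv ^^ n) ((pderiv P * E) * E ^ n) +
      ((pderiv ^^ n) ((of_nat (Suc n) * P * pderiv E) * E ^ n) -
       of_nat (fact n) * (of_nat (Suc n) * P * pderiv E) * pderiv E ^ n)"
    by (simp only: add_diff_eq)
  moreover have "E dvd (pderiv ^^ n) ((pderiv P * E) * E ^ n)"
  proof -
    have "E dvd of_nat (fact n) * (pderiv P * E) * pderiv E ^ n"
      by (simp add: dvd_mult dvd_mult2)
    from dvd_add[OF Suc.IH[of "pderiv P * E"] this] show ?thesis
      by simp
  qed
  ultimately show ?case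
    by (simp only: dvd_add[OF _ Suc.IH])
qed simp

text \<open>This is the factor that \<open>p - 1\<close> derivatives put on a coefficient. Among the
  \<open>p - 1\<close> consecutive numbers after \<open>j\<close> there is a multiple of
  \<open>p\<close> unless \<open>p\<close> divides \<open>j\<close>, and then they are congruent to
  1, ..., p - 1.\<close>

lemma pochhammer_of_nat_Suc_CHAR:
  assumes "prime CHAR('a::idom)"
  shows "pochhammer (of_nat (Suc j) :: 'a) (CHAR('a) - 1) =
    (if CHAR('a) dvd j then of_nat (fact (CHAR('a) - 1)) else 0)"
proof (cases "CHAR('a) dvd j")
  case True
  have "(of_nat (Suc j) :: 'a) = 1"
    using True by (simp add: of_nat_eq_0_iff_char_dvd)
  then show ?thesis
    using True pochhammer_of_nat[of 1 "CHAR('a) - 1", where 'a = 'a] by (simp add: pochhammer_fact)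
next
  case False
  let ?p = "CHAR('a)"
  have p: "?p > 0"
    using assms prime_gt_0_nat by blast
  \<comment> \<open>\<open>Suc j + i\<close> is the first multiple of \<open>p\<close> after
    \<open>j\<close>.\<close>
  define i where "i = ?p - 1 - j mod ?p"
  have r: "j mod ?p > 0" "j mod ?p < ?p"
    using False p by (auto simp: dvd_eq_mod_eq_0)
  have "Suc j + i = j - j mod ?p + ?p"
    using r mod_less_eq_dividend[of j ?p] unfolding i_def by linarith
  also have "?p dvd \<dots>"
    by (rule dvd_add) (simp_all add: dvd_minus_mod)
  finally have "(of_nat (Suc j + i) :: 'a) = 0"
    by (simp only: of_nat_eq_0_iff_char_dvd)
  then have "(of_nat (Suc j) + of_nat i :: 'a) = 0"
    by (simp only: of_nat_add)
  moreover have "i < ?p - 1"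
    using r unfolding i_def by linarith
  ultimately show ?thesis
    using False unfolding pochhammer_prod by (auto intro!: prod_zero)
qed

lemma sum_monom_coeff_residue_class:
  fixes G :: "'a::comm_ring_1 poly"
  assumes "p > 0"
  shows "Polynomial.coeff (\<Sum>j\<le>Polynomial.degree G.
      Polynomial.monom (Polynomial.coeff G (p * j + s)) (p * j)) n =
    (if p dvd n then Polynomial.coeff G (n + s) else 0)"
proof (cases "p dvd n")
  case True
  then obtain m where m: "n = p * m" ..
  have "Polynomial.coeff (\<Sum>j\<le>Polynomial.degree G.
      Polynomial.monom (Polynomial.coeff G (p * j + s)) (p * j)) n =
    (\<Sum>j\<le>Polynomial.degree G. if j = m then Polynomial.coeff G (p * j + s) else 0)"
    using assms by (auto simp: coeff_sum m intro!: sum.cong)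
  \<comment> \<open>Cutting the sum off at the degree loses nothing, because
    \<open>p * m + s \<ge> m\<close>.\<close>
  also have "\<dots> = Polynomial.coeff G (p * m + s)"
  proof (cases "m \<le> Polynomial.degree G")
    case False
    then have "p * m + s > Polynomial.degree G"
      using mult_le_mono1[of 1 p m] assms by linarith
    then show ?thesis
      using False by (simp add: coeff_eq_0)
  qed simp
  finally show ?thesis
    using m by simp
qed (auto simp: coeff_sum intro!: sum.neutral)

lemma higher_pderiv_CHAR_minus_1:
  fixes G :: "'a::idom poly"
  assumes "prime CHAR('a)"
  shows "(pderiv ^^ (CHAR('a) - 1)) G = of_nat (fact (CHAR('a) - 1)) *
    (\<Sum>j\<le>Polynomial.degree G. Polynomial.monom
       (Polynomial.coeff G (CHAR('a) * j + (CHAR('a) - 1))) (CHAR('a) * j))"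
proof -
  have "CHAR('a) > 0"
    using assms prime_gt_0_nat by blast
  then show ?thesis
    by (intro poly_eqI) (simp only: coeff_higher_pderiv pochhammer_of_nat_Suc_CHAR[OF assms]
        of_nat_poly coeff_pCons_0 mult_pCons_left add_0_right coeff_smult mult_zero_left
        sum_monom_coeff_residue_class pCons_0_0, simp)
qed

section \<open>Sections in one and two variables\<close>

text \<open>The section operator on \<open>k[t]\<close>; \<open>inv_into\<close> stands for the
  \<open>p\<close>-th root in \<open>k\<close>.\<close>

definition poly_section :: "nat \<Rightarrow> 'a::field poly \<Rightarrow> 'a poly" where
  "poly_section r g = (\<Sum>i\<le>Polynomial.degree g. Polynomial.monom
     (inv_into UNIV (\<lambda>x. x ^ CHAR('a)) (Polynomial.coeff g (CHAR('a) * i + r))) i)"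

text \<open>Frobenius is injective, by the freshman's dream for \<open>(x - y) + y\<close>. Roots of
  vanishing coefficients thus vanish, on which the degree bounds depend.\<close>

lemma inv_power_CHAR_0:
  assumes "CHAR('a::field) > 0"
  shows "inv_into UNIV (\<lambda>x::'a. x ^ CHAR('a)) 0 = 0"
proof (rule inv_f_eq)
  show "inj (\<lambda>x::'a. x ^ CHAR('a))"
  proof (rule injI)
    fix x y :: 'a
    assume "x ^ CHAR('a) = y ^ CHAR('a)"
    moreover have "((x - y) + y) ^ CHAR('a) = (x - y) ^ CHAR('a) + y ^ CHAR('a)"
      by (rule freshmans_dream) (simp_all add: assms prime_CHAR_semidom)
    ultimately show "x = y"
      by simp
  qed
qed (simp add: assms)

lemma poly_section_0:
  assumes "CHAR('a::field) > 0"
  shows "poly_section r (0 :: 'a poly) = 0"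
  by (simp add: poly_section_def inv_power_CHAR_0[OF assms])

lemma coeff_poly_section_eq_0:
  assumes "CHAR('a::field) > 0" and "\<And>n. n \<ge> CHAR('a) * h \<Longrightarrow> Polynomial.coeff g n = 0"
    and "i \<ge> h"
  shows "Polynomial.coeff (poly_section r (g :: 'a poly)) i = 0"
proof -
  have "CHAR('a) * h \<le> CHAR('a) * i + r"
    using assms(3) by (simp add: trans_le_add1)
  then have "Polynomial.coeff g (CHAR('a) * i + r) = 0"
    by (rule assms(2))
  then show ?thesis
    by (auto simp: poly_section_def coeff_sum inv_power_CHAR_0[OF assms(1)] intro!: sum.neutral)
qed

text \<open>The \<open>p\<close>-th power undoes the roots, and division with remainder
  \<open>n = p * i + r\<close> regroups the monomials of \<open>g\<close>.\<close>

lemma sum_poly_section_power: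
  fixes g :: "'a::field poly"
  assumes p: "CHAR('a) > 0" and surj: "surj (\<lambda>x::'a. x ^ CHAR('a))"
  shows "(\<Sum>r<CHAR('a). Polynomial.monom 1 r * poly_section r g ^ CHAR('a)) = g"
proof -
  let ?p = "CHAR('a)" and ?N = "Suc (Polynomial.degree g)"
  have prime: "prime ?p"
    using p by (rule prime_CHAR_semidom)
  have pow: "poly_section r g ^ ?p = (\<Sum>i<?N. Polynomial.monom (Polynomial.coeff g (?p * i + r)) (?p * i))" for r
    unfolding poly_section_def lessThan_Suc_atMost
    by (subst freshmans_dream_sum)
      (simp_all add: prime monom_power surj_f_inv_f[OF surj] mult.commute)
  have "(\<Sum>r<?p. Polynomial.monom 1 r * poly_section r g ^ ?p) =
      (\<Sum>i<?N. \<Sum>r<?p. Polynomial.monom (Polynomial.coeff g (?p * i + r)) (?p * i + r))"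
    unfolding pow sum_distrib_left by (subst sum.swap) (simp add: mult_monom add.commute)
  also have "\<dots> = (\<Sum>i<?N. \<Sum>n\<in>{i * ?p..<i * ?p + ?p}. Polynomial.monom (Polynomial.coeff g n) n)"
  proof (rule sum.cong[OF refl])
    fix i
    show "(\<Sum>r<?p. Polynomial.monom (Polynomial.coeff g (?p * i + r)) (?p * i + r)) =
        (\<Sum>n\<in>{i * ?p..<i * ?p + ?p}. Polynomial.monom (Polynomial.coeff g n) n)"
      by (rule sum.reindex_bij_witness[of _ "\<lambda>n. n - i * ?p" "\<lambda>r. ?p * i + r"]) (auto simp: mult.commute)
  qed
  also have "\<dots> = (\<Sum>n<?N * ?p. Polynomial.monom (Polynomial.coeff g n) n)"
    by (rule sum.nat_group)
  \<comment> \<open>The blocks of length \<open>p\<close> overshoot the degree, where all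
    coefficients are zero.\<close>
  also have "\<dots> = (\<Sum>n\<le>Polynomial.degree g. Polynomial.monom (Polynomial.coeff g n) n)"
  proof (rule sum.mono_neutral_right)
    show "{..Polynomial.degree g} \<subseteq> {..<?N * ?p}"
    proof
      fix n assume "n \<in> {..Polynomial.degree g}"
      then have "n < ?N"
        by simp
      also have "?N \<le> ?N * ?p"
        using mult_le_mono2[of 1 ?p ?N] p by simp
      finally show "n \<in> {..<?N * ?p}"
        by simp
    qed
  qed (auto simp: coeff_eq_0)
  also have "\<dots> = g"
    by (rule poly_as_sum_of_monoms)
  finally show ?thesis .
qed

text \<open>With \<open>s = p - 1\<close> and \<open>G = P * E ^ (p - 1)\<close> this is the
  numerator \<open>Q\<close> sought.\<close>

definition bipoly_section :: "nat \<Rightarrow> nat \<Rightarrow> 'a::field poly poly \<Rightarrow> 'a poly poly" where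
  "bipoly_section r s G = (\<Sum>j\<le>Polynomial.degree G.
     Polynomial.monom (poly_section r (Polynomial.coeff G (CHAR('a) * j + s))) j)"

lemma sum_bipoly_section_power:
  fixes G :: "'a::field poly poly"
  assumes p: "CHAR('a) > 0" and surj: "surj (\<lambda>x::'a. x ^ CHAR('a))"
  shows "(\<Sum>r<CHAR('a). [:Polynomial.monom 1 r:] * bipoly_section r s G ^ CHAR('a)) =
    (\<Sum>j\<le>Polynomial.degree G. Polynomial.monom (Polynomial.coeff G (CHAR('a) * j + s)) (CHAR('a) * j))"
proof -
  let ?p = "CHAR('a)"
  have prime: "prime ?p"
    using p by (rule prime_CHAR_semidom)
  have "bipoly_section r s G ^ ?p = (\<Sum>j\<le>Polynomial.degree G. Polynomial.monom
      (poly_section r (Polynomial.coeff G (?p * j + s)) ^ ?p) (?p * j))" for r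
    unfolding bipoly_section_def
    by (subst freshmans_dream_sum) (simp_all add: prime monom_power mult.commute)
  then have "(\<Sum>r<?p. [:Polynomial.monom 1 r:] * bipoly_section r s G ^ ?p) =
      (\<Sum>j\<le>Polynomial.degree G. \<Sum>r<?p. Polynomial.monom
        (Polynomial.monom 1 r * poly_section r (Polynomial.coeff G (?p * j + s)) ^ ?p) (?p * j))"
    by (simp only: sum_distrib_left) (subst sum.swap, simp add: smult_monom)
  also have "\<dots> = (\<Sum>j\<le>Polynomial.degree G. Polynomial.monom (\<Sum>r<?p.
        Polynomial.monom 1 r * poly_section r (Polynomial.coeff G (?p * j + s)) ^ ?p) (?p * j))"
    by (simp add: monom_sum)
  finally show ?thesis
    by (simp only: sum_poly_section_power[OF p surj])
qed

lemma dvd_sum_bipoly_section_power: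
  fixes P E :: "'a::field poly poly"
  assumes p: "CHAR('a) > 0" and surj: "surj (\<lambda>x::'a. x ^ CHAR('a))"
  shows "E dvd P * pderiv E ^ (CHAR('a) - 1) - (\<Sum>r<CHAR('a). [:Polynomial.monom 1 r:] *
    bipoly_section r (CHAR('a) - 1) (P * E ^ (CHAR('a) - 1)) ^ CHAR('a))" (is "E dvd ?A - ?S")
proof -
  let ?p = "CHAR('a)"
  have prime: "prime ?p"
    using p by (rule prime_CHAR_semidom)
  \<comment> \<open>The constant \<open>(p - 1)!\<close> is invertible in \<open>k\<close>, as
    \<open>p\<close> does not divide it, and will be cancelled.\<close>
  define c :: 'a where "c = of_nat (fact (?p - 1))"
  have c: "c \<noteq> 0"
    using prime prime_gt_0_nat[OF prime]
    by (simp add: c_def of_nat_eq_0_iff_char_dvd prime_dvd_fact_iff)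
  have of_nat: "(of_nat (fact (?p - 1)) :: 'a poly poly) = [:[:c:]:]"
    by (simp add: c_def of_nat_poly)
  have "E dvd (pderiv ^^ (?p - 1)) (P * E ^ (?p - 1)) - [:[:c:]:] * P * pderiv E ^ (?p - 1)"
    using dvd_higher_pderiv_mult_power[of E "?p - 1" P] unfolding of_nat .
  also have "(pderiv ^^ (?p - 1)) (P * E ^ (?p - 1)) = [:[:c:]:] * ?S"
    using higher_pderiv_CHAR_minus_1[of "P * E ^ (?p - 1)"] prime
    unfolding sum_bipoly_section_power[OF p surj] semiring_char_poly of_nat by blast
  finally have "E dvd [:[:inverse c:]:] * ([:[:c:]:] * ?S - [:[:c:]:] * P * pderiv E ^ (?p - 1))"
    by (rule dvd_mult)
  also have "\<dots> = [:[:inverse c:]:] * [:[:c:]:] * (?S - ?A)"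
    by (simp only: right_diff_distrib mult.assoc)
  also have "\<dots> = ?S - ?A"
    using c by (simp flip: one_pCons)
  finally show ?thesis
    by (subst dvd_minus_iff[symmetric]) simp
qed

section \<open>Degree bounds\<close>

lemma deg_y_less_iff: "deg_y_less P d \<longleftrightarrow> (\<forall>j\<ge>d. Polynomial.coeff P j = 0)"
proof
  assume "\<forall>j\<ge>d. Polynomial.coeff P j = 0"
  then show "deg_y_less P d"
    unfolding deg_y_less_def by (metis leading_coeff_0_iff not_le)
qed (auto simp: deg_y_less_def coeff_eq_0)

lemma degree_coeff_le_deg_t: "Polynomial.degree (Polynomial.coeff P i) \<le> deg_t P"
proof (cases "i \<le> Polynomial.degree P")
  case True
  then show ?thesis
    unfolding deg_t_def by (intro Max_ge) auto
qed (simp add: coeff_eq_0)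

lemma coeff_coeff_eq_0_deg_t: "j > deg_t P \<Longrightarrow> Polynomial.coeff (Polynomial.coeff P i) j = 0"
  using degree_coeff_le_deg_t[of P i] by (simp add: coeff_eq_0)

text \<open>Vanishing coefficients express the bound uniformly, including \<open>h = 0\<close>,
  where only the zero polynomial qualifies.\<close>

lemma deg_t_less_iff: "deg_t_less P h \<longleftrightarrow> (\<forall>i. \<forall>j\<ge>h. Polynomial.coeff (Polynomial.coeff P i) j = 0)"
proof
  assume *: "\<forall>i. \<forall>j\<ge>h. Polynomial.coeff (Polynomial.coeff P i) j = 0"
  show "deg_t_less P h"
  proof (cases "h = 0")
    case True
    then show ?thesis
      using * by (simp add: deg_t_less_def poly_eq_iff)
  next
    case False
    have "Polynomial.degree (Polynomial.coeff P i) < h" for i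
      using * False by (metis leading_coeff_0_iff not_le degree_0 not_gr0)
    then show ?thesis
      unfolding deg_t_less_def deg_t_def by (subst Max_less_iff) auto
  qed
qed (auto simp: deg_t_less_def coeff_coeff_eq_0_deg_t)

text \<open>A strict bound times a weak one stays strict, so each factor \<open>E\<close> raises the
  bound by exactly \<open>deg_t E\<close>.\<close>

lemma deg_t_less_mult:
  assumes "deg_t_less P m" and "deg_t E \<le> n"
  shows "deg_t_less (P * E) (m + n)"
  unfolding deg_t_less_iff
proof (intro allI impI)
  fix i j assume j: "j \<ge> m + n"
  have "Polynomial.coeff (Polynomial.coeff P a * Polynomial.coeff E b) j = 0" for a b
    unfolding coeff_mult
  proof (rule sum.neutral, rule ballI)
    fix k assume k: "k \<in> {..j}"
    show "Polynomial.coeff (Polynomial.coeff P a) k * Polynomial.coeff (Polynomial.coeff E b) (j - k) = 0"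
    proof (cases "k \<ge> m")
      case True
      then show ?thesis using assms(1) by (simp add: deg_t_less_iff)
    next
      case False
      then have "j - k > deg_t E" using j assms(2) by linarith
      then show ?thesis by (simp add: coeff_coeff_eq_0_deg_t)
    qed
  qed
  then show "Polynomial.coeff (Polynomial.coeff (P * E) i) j = 0"
    unfolding coeff_mult[of P] by (simp add: coeff_sum)
qed

lemma deg_t_less_mult_power:
  assumes "deg_t_less P (deg_t E)"
  shows "deg_t_less (P * E ^ n) (Suc n * deg_t E)"
proof (induction n)
  case (Suc n)
  from deg_t_less_mult[OF this order_refl] show ?case
    by (simp add: algebra_simps)
qed (use assms in simp)

lemma deg_y_less_mult_power:
  assumes "deg_y_less P (Polynomial.degree E)"
  shows "deg_y_less (P * E ^ n) (Suc n * Polynomial.degree E)"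
proof (cases "P * E ^ n = 0")
  case False
  then have "Polynomial.degree (P * E ^ n) = Polynomial.degree P + n * Polynomial.degree E"
    by (auto simp: degree_mult_eq degree_power_eq)
  then show ?thesis
    using False assms by (auto simp: deg_y_less_def)
qed (simp add: deg_y_less_def)

text \<open>Sections divide degree bounds by \<open>p\<close>: exponent \<open>j\<close> of a
  section comes from an exponent at least \<open>p * j\<close>.\<close>

lemma
  fixes G :: "'a::field poly poly"
  assumes p: "CHAR('a) > 0"
  shows deg_t_less_bipoly_section:
      "deg_t_less G (CHAR('a) * h) \<Longrightarrow> deg_t_less (bipoly_section r s G) h"
    and deg_y_less_bipoly_section:
      "deg_y_less G (CHAR('a) * d) \<Longrightarrow> deg_y_less (bipoly_section r s G) d"
proof -
  assume "deg_t_less G (CHAR('a) * h)"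
  then have "Polynomial.coeff (poly_section r (Polynomial.coeff G m)) j = 0" if "j \<ge> h" for m j
    by (intro coeff_poly_section_eq_0[OF p _ that]) (auto simp: deg_t_less_iff)
  then show "deg_t_less (bipoly_section r s G) h"
    by (auto simp: deg_t_less_iff bipoly_section_def coeff_sum intro!: sum.neutral)
next
  assume G: "deg_y_less G (CHAR('a) * d)"
  have "poly_section r (Polynomial.coeff G (CHAR('a) * j + s)) = 0" if "j \<ge> d" for j
  proof -
    have "CHAR('a) * d \<le> CHAR('a) * j + s"
      using that by (simp add: trans_le_add1)
    then show ?thesis
      using G poly_section_0[OF p] by (simp add: deg_y_less_iff)
  qed
  then show "deg_y_less (bipoly_section r s G) d"
    by (auto simp: deg_y_less_iff bipoly_section_def coeff_sum intro!: sum.neutral)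
qed

section \<open>Evaluation in Laurent series\<close>

text \<open>A nonzero element \<open>D\<close> of least degree in the ideal of \<open>F\<close> and
  \<open>G\<close> divides the whole ideal, by division with remainder. As a divisor of
  \<open>F\<close> it is a unit, for otherwise \<open>F\<close> would divide \<open>D\<close> and
  hence \<open>G\<close>.\<close>

lemma irreducible_bezout:
  fixes F G :: "'a::field poly"
  assumes irr: "Factorial_Ring.irreducible F" and ndvd: "\<not> F dvd G"
  obtains U V where "U * F + V * G = 1"
proof -
  define S where "S = {D. D \<noteq> 0 \<and> (\<exists>U V. D = U * F + V * G)}"
  have "F \<noteq> 0" "F = 1 * F + 0 * G"
    using irr by (auto simp: irreducible_def)
  then have "F \<in> S"
    unfolding S_def by blast
  then obtain D where "D \<in> S" and "\<And>D'. D' \<in> S \<Longrightarrow> Polynomial.degree D \<le> Polynomial.degree D'"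
    using ex_has_least_nat[of "\<lambda>D. D \<in> S" F Polynomial.degree] by blast
  note min = this
  from \<open>D \<in> S\<close> obtain U V where D: "D \<noteq> 0" "D = U * F + V * G"
    by (auto simp: S_def)
  have dvd: "D dvd A * F + B * G" for A B
  proof (rule ccontr)
    assume "\<not> ?thesis"
    then have nz: "(A * F + B * G) mod D \<noteq> 0"
      by (simp add: dvd_eq_mod_eq_0)
    define q where "q = (A * F + B * G) div D"
    have "(A * F + B * G) mod D = A * F + B * G - q * (U * F + V * G)"
      unfolding q_def D(2)[symmetric] by (simp add: minus_div_mult_eq_mod)
    also have "\<dots> = (A - q * U) * F + (B - q * V) * G"
      by (simp add: algebra_simps)
    finally have "(A * F + B * G) mod D \<in> S"
      using nz unfolding S_def by blast
    then have "Polynomial.degree D \<le> Polynomial.degree ((A * F + B * G) mod D)"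
      by (rule min)
    then show False
      using degree_mod_less[OF D(1), of "A * F + B * G"] nz by simp
  qed
  have "D dvd F" "D dvd G"
    using dvd[of 1 0] dvd[of 0 1] by simp_all
  moreover from \<open>D dvd F\<close> irr have "D dvd 1 \<or> F dvd D"
    using irreducibleD' by blast
  ultimately have "D dvd 1"
    using ndvd dvd_trans by blast
  then obtain C where "1 = D * C" ..
  then have "(C * U) * F + (C * V) * G = 1"
    using D(2) by (simp add: algebra_simps)
  then show thesis
    by (rule that)
qed

lemma fps_of_poly_eq_0_iff: "fps_of_poly a = 0 \<longleftrightarrow> a = 0"
  using fps_of_poly_eq_iff[of a 0] by simp

text \<open>The inclusion of \<open>k(t)\<close> in \<open>k((t))\<close>; the next lemma shows
  independence of the chosen quotient.\<close>

definition fls_of_fract :: "'a::field poly fract \<Rightarrow> 'a fls" where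
  "fls_of_fract x = (THE y. \<exists>a b. b \<noteq> 0 \<and> x = Fract a b \<and>
     y = fps_to_fls (fps_of_poly a) / fps_to_fls (fps_of_poly b))"

lemma fls_of_fract_Fract:
  assumes "b \<noteq> 0"
  shows "fls_of_fract (Fract a b) = fps_to_fls (fps_of_poly a) / fps_to_fls (fps_of_poly b)"
  unfolding fls_of_fract_def
proof (rule the_equality)
  fix y assume "\<exists>a' b'. b' \<noteq> 0 \<and> Fract a b = Fract a' b' \<and>
      y = fps_to_fls (fps_of_poly a') / fps_to_fls (fps_of_poly b')"
  then obtain a' b' where *: "b' \<noteq> 0" "a * b' = a' * b"
      "y = fps_to_fls (fps_of_poly a') / fps_to_fls (fps_of_poly b')"
    using assms by (auto simp: eq_fract)
  from arg_cong[OF *(2), of "\<lambda>c. fps_to_fls (fps_of_poly c)"]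
  show "y = fps_to_fls (fps_of_poly a) / fps_to_fls (fps_of_poly b)"
    using *(1,3) assms
    by (simp add: frac_eq_eq fps_of_poly_mult fls_times_fps_to_fls fps_of_poly_eq_0_iff)
qed (use assms in blast)

lemma fls_of_fract_add: "fls_of_fract (x + y) = fls_of_fract x + fls_of_fract y"
  by (cases x; cases y)
    (simp add: fls_of_fract_Fract add_frac_eq fps_of_poly_eq_0_iff fps_of_poly_add fps_of_poly_mult
      fls_times_fps_to_fls)

lemma fls_of_fract_mult: "fls_of_fract (x * y) = fls_of_fract x * fls_of_fract y"
  by (cases x; cases y)
    (simp add: fls_of_fract_Fract fps_of_poly_mult fls_times_fps_to_fls)

lemma fls_of_fract_to_fract: "fls_of_fract (to_fract a) = fps_to_fls (fps_of_poly a)"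
  by (simp add: to_fract_def fls_of_fract_Fract)

lemma fls_of_fract_0 [simp]: "fls_of_fract 0 = 0"
  using fls_of_fract_to_fract[of 0] by simp

lemma fls_of_fract_1 [simp]: "fls_of_fract 1 = 1"
  using fls_of_fract_to_fract[of 1] by simp

text \<open>The homomorphism from \<open>k(t)[y]\<close> to \<open>k((t))\<close> with
  \<open>y\<close> sent to \<open>f\<close>.\<close>

definition fls_eval :: "'a::field fps \<Rightarrow> 'a poly fract poly \<Rightarrow> 'a fls" where
  "fls_eval f G = poly (map_poly fls_of_fract G) (fps_to_fls f)"

lemma fls_eval_0 [simp]: "fls_eval f 0 = 0"
  by (simp add: fls_eval_def)

lemma fls_eval_pCons: "fls_eval f (pCons a G) = fls_of_fract a + fps_to_fls f * fls_eval f G"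
  by (simp add: fls_eval_def map_poly_pCons)

lemma fls_eval_add: "fls_eval f (G + H) = fls_eval f G + fls_eval f H"
  by (induction G H rule: poly_induct2) (simp_all add: fls_eval_pCons fls_of_fract_add algebra_simps)

lemma fls_eval_smult: "fls_eval f (smult a G) = fls_of_fract a * fls_eval f G"
  by (induction G) (simp_all add: fls_eval_pCons fls_of_fract_mult algebra_simps)

lemma fls_eval_mult: "fls_eval f (G * H) = fls_eval f G * fls_eval f H"
  by (induction G) (simp_all add: fls_eval_pCons fls_eval_add fls_eval_smult algebra_simps)

lemma fls_eval_1 [simp]: "fls_eval f 1 = 1"
  by (simp add: fls_eval_pCons one_pCons)

lemma fls_eval_power: "fls_eval f (G ^ n) = fls_eval f G ^ n"
  by (induction n) (simp_all add: fls_eval_mult)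

lemma fls_eval_sum: "fls_eval f (sum G A) = (\<Sum>i\<in>A. fls_eval f (G i))"
  by (induction A rule: infinite_finite_induct) (simp_all add: fls_eval_add)

lemma fls_eval_fract_poly: "fls_eval f (fract_poly P) = fps_to_fls (eval_y P f)"
  by (induction P)
    (simp_all add: eval_y_def map_poly_pCons fls_eval_pCons fls_of_fract_to_fract fls_times_fps_to_fls)

text \<open>If \<open>E\<close> did not divide \<open>G\<close>, evaluating a Bezout identity at the
  root would give 0 = 1. So \<open>L\<close> embeds in \<open>k((t))\<close>.\<close>

lemma fls_eval_eq_0_iff:
  assumes "Factorial_Ring.irreducible (fract_poly E)" and "eval_y E f = 0"
  shows "fls_eval f G = 0 \<longleftrightarrow> fract_poly E dvd G"
proof
  assume 0: "fls_eval f G = 0"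
  show "fract_poly E dvd G"
  proof (rule ccontr)
    assume "\<not> ?thesis"
    then obtain U V where "U * fract_poly E + V * G = 1"
      using irreducible_bezout assms(1) by blast
    from arg_cong[OF this, of "fls_eval f"] show False
      using 0 assms(2) by (simp add: fls_eval_add fls_eval_mult fls_eval_fract_poly)
  qed
qed (use assms(2) in \<open>auto simp: fls_eval_mult fls_eval_fract_poly\<close>)

section \<open>Independence of the powers of \<open>t\<close> over \<open>p\<close>-th
  powers\<close>

lemma sum_fls_X_power_eq_0:
  fixes g :: "nat \<Rightarrow> 'a::field fls"
  assumes sum: "(\<Sum>i<p. fls_X ^ i * g i ^ p) = 0" and i: "i < p"
  shows "g i = 0"
proof (rule ccontr)
  assume "g i \<noteq> 0"
  define T where "T = (\<lambda>i. fls_X ^ i * g i ^ p)"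
  have T: "T j \<noteq> 0 \<longleftrightarrow> g j \<noteq> 0" if "j < p" for j
    using that by (auto simp: T_def)
  have sub: "fls_subdegree (T j) = int j + int p * fls_subdegree (g j)" if "g j \<noteq> 0" for j
    using that by (simp add: T_def fls_subdegree_pow)
  define I where "I = {j. j < p \<and> g j \<noteq> 0}"
  have I: "finite I" "I \<noteq> {}"
    using i \<open>g i \<noteq> 0\<close> by (auto simp: I_def)
  obtain m where m: "m \<in> I" and min: "\<And>j. j \<in> I \<Longrightarrow> fls_subdegree (T m) \<le> fls_subdegree (T j)"
    using ex_is_arg_min_if_finite[OF I, of "\<lambda>j. fls_subdegree (T j)"]
    by (auto simp: is_arg_min_linorder)
  let ?n = "fls_subdegree (T m)"
  have less: "?n < fls_subdegree (T j)" if j: "j \<in> I" "j \<noteq> m" for j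
  proof -
    have "?n mod int p = int m" "fls_subdegree (T j) mod int p = int j"
      using m j by (simp_all add: I_def sub)
    then have "?n \<noteq> fls_subdegree (T j)"
      using j by auto
    with min[OF j(1)] show ?thesis
      by simp
  qed
  have "0 = (\<Sum>j<p. fls_nth (T j) ?n)"
    using arg_cong[OF sum, of "\<lambda>s. fls_nth s ?n"] by (simp add: T_def fls_nth_sum)
  \<comment> \<open>At the least order \<open>?n\<close> only \<open>T m\<close> contributes: the
    other terms vanish or, by the residues modulo \<open>p\<close>, have strictly larger
    order.\<close>
  also have "\<dots> = (\<Sum>j<p. if j = m then fls_nth (T m) ?n else 0)"
  proof (rule sum.cong[OF refl])
    fix j assume "j \<in> {..<p}"
    then show "fls_nth (T j) ?n = (if j = m then fls_nth (T m) ?n else 0)"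
      using less[of j] T[of j] by (cases "g j = 0") (auto simp: I_def)
  qed
  also have "\<dots> = fls_nth (T m) ?n"
    using m by (simp add: I_def)
  finally show False
    using m T by (auto simp: I_def)
qed

lemma irreducible_dvd_sum_t_power:
  assumes "Factorial_Ring.irreducible (fract_poly E)" and "eval_y E f = 0"
    and dvd: "fract_poly E dvd (\<Sum>i<p. fract_poly [:Polynomial.monom 1 i:] * A i ^ p)" and "i < p"
  shows "fract_poly E dvd A i"
proof -
  have "(\<Sum>i<p. fls_X ^ i * fls_eval f (A i) ^ p) = 0"
    using dvd unfolding fls_eval_eq_0_iff[OF assms(1,2), symmetric] fls_eval_sum
    by (simp add: fls_eval_mult fls_eval_power fls_eval_fract_poly eval_y_def fps_of_poly_monom'
        fps_to_fls_power map_poly_pCons fls_eval_smult fls_of_fract_to_fract)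
  from sum_fls_X_power_eq_0[OF this \<open>i < p\<close>] show ?thesis
    by (simp add: fls_eval_eq_0_iff[OF assms(1,2)])
qed

section \<open>Homomorphisms from polynomial types\<close>

text \<open>This links polynomials as a type with rings given by a carrier: \<open>\<Phi>\<close>
  extends \<open>\<psi>\<close> and sends the variable to \<open>x\<close>. It is used with
  \<open>k(t)[y]\<close> as coefficients and \<open>t^(1/p)\<close> as \<open>x\<close>.\<close>

locale poly_type_hom = cring S for S :: "('s, 'm) ring_scheme" (structure) +
  fixes \<psi> :: "'c::comm_ring_1 \<Rightarrow> 's" and x
  assumes \<psi>_closed [simp]: "\<psi> a \<in> carrier S"
    and \<psi>_add: "\<psi> (a + b) = \<psi> a \<oplus> \<psi> b"
    and \<psi>_mult: "\<psi> (a * b) = \<psi> a \<otimes> \<psi> b"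
    and \<psi>_1: "\<psi> 1 = \<one>"
    and x_closed [simp]: "x \<in> carrier S"
begin

definition \<Phi> :: "'c poly \<Rightarrow> 's" where
  "\<Phi> W = fold_coeffs (\<lambda>a s. \<psi> a \<oplus> x \<otimes> s) W \<zero>"

lemma \<psi>_0: "\<psi> 0 = \<zero>"
proof -
  have "\<psi> 0 \<oplus> \<psi> 0 = \<psi> 0 \<oplus> \<zero>"
    using \<psi>_add[of 0 0] by simp
  then show ?thesis
    by (simp only: add.l_cancel \<psi>_closed zero_closed)
qed

lemma \<Phi>_0: "\<Phi> 0 = \<zero>"
  by (simp add: \<Phi>_def)

lemma \<Phi>_pCons: "\<Phi> (pCons a W) = \<psi> a \<oplus> x \<otimes> \<Phi> W"
proof (cases "a = 0 \<and> W = 0")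
  case True
  then show ?thesis
    by (simp add: \<Phi>_0 \<psi>_0)
qed (auto simp: \<Phi>_def)

lemma \<Phi>_closed [simp]: "\<Phi> W \<in> carrier S"
  by (induction W) (simp_all add: \<Phi>_0 \<Phi>_pCons)

lemma \<Phi>_add: "\<Phi> (W + V) = \<Phi> W \<oplus> \<Phi> V"
  by (induction W V rule: poly_induct2) (simp_all add: \<Phi>_0 \<Phi>_pCons \<psi>_add r_distr a_ac)

lemma \<Phi>_smult: "\<Phi> (smult a W) = \<psi> a \<otimes> \<Phi> W"
  by (induction W) (simp_all add: \<Phi>_0 \<Phi>_pCons \<psi>_mult r_distr m_ac)

lemma \<Phi>_mult: "\<Phi> (W * V) = \<Phi> W \<otimes> \<Phi> V"
  by (induction W) (simp_all add: \<Phi>_0 \<Phi>_pCons \<Phi>_add \<Phi>_smult \<psi>_0 l_distr m_assoc)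

lemma \<Phi>_const: "\<Phi> [:a:] = \<psi> a"
  by (simp add: \<Phi>_0 \<Phi>_pCons)

lemma \<Phi>_1: "\<Phi> 1 = \<one>"
  by (simp add: one_pCons \<Phi>_const \<psi>_1)

lemma \<Phi>_power: "\<Phi> (W ^ n) = \<Phi> W [^] n"
  by (induction n) (simp_all add: \<Phi>_1 \<Phi>_mult m_comm)

lemma \<Phi>_monom: "\<Phi> (Polynomial.monom a n) = x [^] n \<otimes> \<psi> a"
  by (induction n) (simp_all add: monom_0 monom_Suc \<Phi>_0 \<Phi>_const \<Phi>_pCons \<psi>_0 m_ac)

lemma \<psi>_power: "\<psi> (a ^ n) = \<psi> a [^] n"
  by (induction n) (simp_all add: \<psi>_1 \<psi>_mult m_comm)

lemma \<Phi>_sum_monom: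
  "\<Phi> (\<Sum>i<n. Polynomial.monom (a i) i) = (\<Oplus>i\<in>{..<n}. x [^] i \<otimes> \<psi> (a i))"
  by (induction n) (simp_all add: \<Phi>_0 lessThan_Suc \<Phi>_add \<Phi>_monom Pi_def)

lemma eval_in_range_\<Phi>:
  assumes "set ls \<subseteq> range \<psi>"
  shows "eval ls x \<in> range \<Phi>"
  using assms
proof (induction ls)
  case Nil
  then show ?case
    using \<Phi>_0 by (metis eval.simps(1) rangeI)
next
  case (Cons y ls)
  then obtain a W where "y = \<psi> a" "eval ls x = \<Phi> W"
    by auto
  \<comment> \<open>Coefficient lists start with the leading coefficient, so \<open>y\<close>
    belongs to exponent \<open>length ls\<close>.\<close>
  then have "eval (y # ls) x = \<Phi> (Polynomial.monom a (length ls) + W)"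
    by (simp add: \<Phi>_add \<Phi>_monom m_comm)
  then show ?case
    by blast
qed

end

locale poly_type_hom_root = poly_type_hom S \<psi> x
  for S :: "('s, 'm) ring_scheme" (structure) and \<psi> :: "'c::comm_ring_1 \<Rightarrow> 's" and x +
  fixes p :: nat and t :: 'c
  assumes p_pos: "p > 0" and x_power_p: "x [^] p = \<psi> t"
begin

lemma \<Phi>_reduce:
  obtains V where "\<And>i. i \<ge> p \<Longrightarrow> Polynomial.coeff V i = 0" and "\<Phi> V = \<Phi> W"
proof -
  have "\<exists>V. (\<forall>i\<ge>p. Polynomial.coeff V i = 0) \<and> \<Phi> V = \<Phi> W"
  proof (induction W)
    case 0
    show ?case
      by (rule exI[of _ 0]) simp
  next
    case (pCons a W)
    then obtain V where V: "\<And>i. i \<ge> p \<Longrightarrow> Polynomial.coeff V i = 0" "\<Phi> V = \<Phi> W"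
      by blast
    define c where "c = Polynomial.coeff (pCons a V) p"
    \<comment> \<open>The shift by \<open>pCons\<close> can only make the coefficient at
      \<open>p\<close> too high; \<open>x [^] p = \<psi> t\<close> moves it to the constant
      term.\<close>
    define V' where "V' = pCons a V - Polynomial.monom c p + [:c * t:]"
    have "V' + Polynomial.monom c p = pCons a V + [:c * t:]"
      by (simp add: V'_def)
    from arg_cong[OF this, of \<Phi>]
    have "\<Phi> V' \<oplus> \<Phi> (Polynomial.monom c p) = \<Phi> (pCons a V) \<oplus> \<Phi> [:c * t:]"
      by (simp only: \<Phi>_add)
    moreover have "\<Phi> (Polynomial.monom c p) = \<Phi> [:c * t:]"
      by (simp add: \<Phi>_monom \<Phi>_const x_power_p \<psi>_mult m_comm)
    ultimately have "\<Phi> V' = \<Phi> (pCons a V)"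
      by (simp only: add.r_cancel \<Phi>_closed)
    then have "\<Phi> V' = \<Phi> (pCons a W)"
      by (simp add: \<Phi>_pCons V(2))
    moreover have "Polynomial.coeff V' i = 0" if "i \<ge> p" for i
      using that p_pos V(1)[of "i - 1"] by (cases i) (auto simp: V'_def c_def)
    ultimately show ?case
      by blast
  qed
  then show thesis
    using that by blast
qed

lemma \<Phi>_sum_monom_multiple:
  "\<Phi> (\<Sum>i<n. Polynomial.monom (a i) (i * p)) = \<psi> (\<Sum>i<n. t ^ i * a i)"
proof (induction n)
  case (Suc n)
  have "x [^] (n * p) = \<psi> (t ^ n)"
    by (simp add: \<psi>_power nat_pow_pow mult.commute[of n] flip: x_power_p)
  with Suc show ?case
    by (simp add: \<Phi>_add \<Phi>_monom \<psi>_add \<psi>_mult)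
qed (simp add: \<Phi>_0 \<psi>_0)

text \<open>The Frobenius formula on \<open>L[t^(1/p)]\<close>: the freshman's dream is applied to
  polynomials over \<open>'c\<close> and carried over by \<open>\<Phi>\<close>.\<close>

lemma \<Phi>_power_p:
  assumes "prime p" and "CHAR('c) = p"
  shows "\<Phi> (\<Sum>i<p. Polynomial.monom (a i) i) [^] p = \<psi> (\<Sum>i<p. t ^ i * a i ^ p)"
proof -
  have "(\<Sum>i<p. Polynomial.monom (a i) i) ^ p = (\<Sum>i<p. Polynomial.monom (a i ^ p) (i * p))"
    unfolding monom_power[symmetric] by (rule freshmans_dream_sum) (simp_all add: assms)
  then show ?thesis
    by (simp only: \<Phi>_sum_monom_multiple flip: \<Phi>_power)
qed

end

section \<open>The field \<open>L\<close> and its extension by a \<open>p\<close>-th root of \<open>t\<close>\<close>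

lemma kt_y_simps [simp]:
  "carrier kt_y = UNIV" "x \<otimes>\<^bsub>kt_y\<^esub> y = x * y" "x \<oplus>\<^bsub>kt_y\<^esub> y = x + y"
  "\<one>\<^bsub>kt_y\<^esub> = 1" "\<zero>\<^bsub>kt_y\<^esub> = 0"
  by (simp_all add: kt_y_def ring_of_type_algebra_def)

lemma cring_kt_y: "cring kt_y"
  unfolding kt_y_def by (rule cring_from_type_algebra)

section \<open>The field \<open>L\<close>\<close>

locale rooted_irreducible =
  fixes E :: "'k::field poly poly" and f :: "'k fps"
  assumes irr: "Factorial_Ring.irreducible (fract_poly E)" and root: "eval_y E f = 0"
begin

abbreviation L where "L \<equiv> L_ring E"

definition cls :: "'k poly fract poly \<Rightarrow> 'k poly fract poly set" where
  "cls G = PIdl\<^bsub>kt_y\<^esub> (fract_poly E) +>\<^bsub>kt_y\<^esub> G"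

text \<open>Cosets are the fibres of \<open>fls_eval f\<close>, whose kernel is the ideal of
  \<open>E\<close>. Identities in \<open>L\<close> can thus be checked on Laurent series.\<close>

lemma cls_eq_iff: "cls G = cls H \<longleftrightarrow> fls_eval f G = fls_eval f H"
proof -
  have *: "cls G = {A. fls_eval f A = fls_eval f G}" for G
  proof -
    have "cls G = {A. fract_poly E dvd A - G}"
      unfolding cls_def a_r_coset_def' cgenideal_def
      by (auto simp: dvd_def mult.commute) (metis diff_add_cancel mult.commute)
    moreover have "fract_poly E dvd A - G \<longleftrightarrow> fls_eval f A = fls_eval f G" for A
      using fls_eval_add[of f "A - G" G] by (simp flip: fls_eval_eq_0_iff[OF irr root])
    ultimately show ?thesis
      by simp
  qed
  show ?thesis
    unfolding * by auto
qed

lemma ideal_PIdl: "ideal (PIdl\<^bsub>kt_y\<^esub> (fract_poly E)) kt_y"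
  by (rule cring.cgenideal_ideal[OF cring_kt_y]) simp

lemma carrier_L: "carrier L = range cls"
  by (auto simp: L_ring_def FactRing_def A_RCOSETS_def' cls_def)

lemma cls_hom: "cls \<in> ring_hom kt_y L"
  using ideal.rcos_ring_hom[OF ideal_PIdl] unfolding L_ring_def cls_def[abs_def] .

lemma
  shows cls_closed [simp]: "cls G \<in> carrier L"
    and cls_mult: "cls (G * H) = cls G \<otimes>\<^bsub>L\<^esub> cls H"
    and cls_add: "cls (G + H) = cls G \<oplus>\<^bsub>L\<^esub> cls H"
    and cls_1: "cls 1 = \<one>\<^bsub>L\<^esub>"
  using ring_hom_memE[OF cls_hom] by simp_all

lemma cring_L: "cring L"
  unfolding L_ring_def by (rule ideal.quotient_is_cring[OF ideal_PIdl cring_kt_y])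

lemma cls_0: "cls 0 = \<zero>\<^bsub>L\<^esub>"
  using ring_hom_zero[OF cls_hom cring.axioms(1)[OF cring_kt_y] cring.axioms(1)[OF cring_L]] by simp

lemma ex_inverse_mod:
  assumes "fls_eval f G \<noteq> 0"
  obtains U where "fls_eval f U * fls_eval f G = 1"
proof -
  have "\<not> fract_poly E dvd G"
    using assms fls_eval_eq_0_iff[OF irr root] by blast
  then obtain V U where "V * fract_poly E + U * G = 1"
    using irreducible_bezout[OF irr] by blast
  from arg_cong[OF this, of "fls_eval f"] show thesis
    using that root by (simp add: fls_eval_add fls_eval_mult fls_eval_fract_poly)
qed

lemma field_L: "field L"
proof (rule cring.cring_fieldI2[OF cring_L])
  show "\<zero>\<^bsub>L\<^esub> \<noteq> \<one>\<^bsub>L\<^esub>"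
    by (simp add: cls_eq_iff flip: cls_0 cls_1)
next
  fix a assume a: "a \<in> carrier L" "a \<noteq> \<zero>\<^bsub>L\<^esub>"
  then obtain G where G: "a = cls G"
    by (auto simp: carrier_L)
  then have "fls_eval f G \<noteq> 0"
    using a(2) by (simp add: cls_eq_iff flip: cls_0)
  then obtain U where "fls_eval f U * fls_eval f G = 1"
    by (rule ex_inverse_mod)
  then have "a \<otimes>\<^bsub>L\<^esub> cls U = \<one>\<^bsub>L\<^esub>"
    by (simp add: G cls_eq_iff fls_eval_mult mult.commute flip: cls_mult cls_1)
  then show "\<exists>b\<in>carrier L. a \<otimes>\<^bsub>L\<^esub> b = \<one>\<^bsub>L\<^esub>"
    using cls_closed by blast
qed

lemma L_class_eq: "L_class E P = cls (fract_poly P)"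
  by (simp add: L_class_def cls_def)

lemma L_over_Ey_eq:
  assumes "fls_eval f U * fls_eval f (fract_poly (pderiv E)) = 1"
  shows "L_over_Ey E P = cls (fract_poly P * U)"
proof -
  interpret L: field L
    by (rule field_L)
  have "cls U = inv\<^bsub>L\<^esub> (L_class E (pderiv E))"
    using assms
    by (intro L.inv_unique') (simp_all add: L_class_eq cls_eq_iff fls_eval_mult mult.commute
        flip: cls_mult cls_1)
  then show ?thesis
    by (simp add: L_over_Ey_def L_class_eq cls_mult)
qed

end

section \<open>The extension \<open>L[t^(1/p)]\<close>\<close>

locale rooted_irreducible_char_p = rooted_irreducible E f
  for E :: "'k::field poly poly" and f +
  fixes p :: nat
  assumes char: "CHAR('k) = p" and p_pos: "p > 0"
begin

abbreviation Lt where "Lt \<equiv> Lt_ring E p"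

abbreviation \<tau> where "\<tau> \<equiv> t_root E p"

abbreviation tp :: "'k poly fract poly" where "tp \<equiv> fract_poly [:[:0, 1:]:]"

sublocale L: field L
  by (rule field_L)

lemma prime_p: "prime p"
  using prime_CHAR_semidom[where 'a = 'k] char p_pos by simp

lemma L_root_poly_closed: "L_root_poly E p \<in> carrier (L_poly E)"
  and degree_L_root_poly: "Polynomials.degree (L_root_poly E p) > 0"
proof -
  interpret UP: domain "L_poly E"
    unfolding L_poly_def by (rule L.univ_poly_is_domain[OF L.carrier_is_subring])
  let ?c = "L.poly_of_const (L_class E [:[:0, 1:]:])"
  have c: "?c \<in> carrier (L_poly E)"
    using ring_hom_memE(1)[OF L.canonical_embedding_is_hom[OF L.carrier_is_subring]]
    by (simp add: L_poly_def L_class_eq)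
  have X: "X\<^bsub>L\<^esub> [^]\<^bsub>L_poly E\<^esub> p \<in> carrier (L_poly E)"
    unfolding L_poly_def by (rule L.var_pow_closed[OF L.carrier_is_subring])
  show "L_root_poly E p \<in> carrier (L_poly E)"
    unfolding L_root_poly_def using c X by (rule UP.minus_closed[rotated])
  have "Polynomials.degree (X\<^bsub>L\<^esub> [^]\<^bsub>L_poly E\<^esub> p) = p"
    unfolding L_poly_def L.unitary_monom_eq_var_pow[OF L.carrier_is_subring, symmetric]
    by (simp add: L.monom_def)
  moreover have "Polynomials.degree (\<ominus>\<^bsub>L_poly E\<^esub> ?c) = 0"
    using L.univ_poly_a_inv_degree[OF L.carrier_is_subring c[unfolded L_poly_def]]
      L.normalize_length_le[of "[L_class E [:[:0, 1:]:]]"]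
    by (simp add: L_poly_def L.poly_of_const_def)
  ultimately have "Polynomials.degree (L_root_poly E p) = p"
    using L.poly_add_degree_eq[OF L.carrier_is_subring, of "X\<^bsub>L\<^esub> [^]\<^bsub>L_poly E\<^esub> p" "\<ominus>\<^bsub>L_poly E\<^esub> ?c"]
      X UP.a_inv_closed[OF c] p_pos
    by (simp add: L_root_poly_def a_minus_def L_poly_def univ_poly_add univ_poly_carrier)
  then show "Polynomials.degree (L_root_poly E p) > 0"
    using p_pos by simp
qed

lemma Lt_class_hom: "ring_hom_ring (L_poly E) Lt (Lt_class E p)"
  using L.rupture_surj_hom(2)[OF L.carrier_is_subring L_root_poly_closed[unfolded L_poly_def]]
  unfolding Lt_ring_def Lt_class_def[abs_def] L_poly_def .

lemma Lt_embed_hom: "ring_hom_ring L Lt (Lt_embed E p)"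
  using ring_hom_ringI2[OF L.ring_axioms ring_hom_ring.axioms(2)[OF Lt_class_hom]]
    L.rupture_surj_norm_is_hom[OF L.carrier_is_subring L_root_poly_closed[unfolded L_poly_def]]
  unfolding Lt_ring_def Lt_embed_def[abs_def] Lt_class_def L_poly_def comp_def by simp

sublocale emb: ring_hom_ring L Lt "Lt_embed E p"
  by (rule Lt_embed_hom)

text \<open>A field maps injectively to any nontrivial ring, and \<open>Lt\<close> is nontrivial
  because \<open>X^p - t\<close> has positive degree.\<close>

lemma inj_Lt_embed: "inj_on (Lt_embed E p) (carrier L)"
proof (rule emb.non_trivial_field_hom_imp_inj[OF field_L])
  have "\<one>\<^bsub>Lt\<^esub> \<noteq> \<zero>\<^bsub>Lt\<^esub>"
    unfolding Lt_ring_def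
    by (rule L.rupture_one_not_zero[OF L.carrier_is_subfield L_root_poly_closed[unfolded L_poly_def]
          degree_L_root_poly])
  then show "Lt_embed E p ` carrier L \<noteq> {\<zero>\<^bsub>Lt\<^esub>}"
    using emb.hom_one L.one_closed by (metis imageI singletonD)
qed

lemma cring_Lt: "cring Lt"
proof -
  have "cring (L_poly E)"
    unfolding L_poly_def by (rule L.univ_poly_is_cring[OF L.carrier_is_subring])
  then show ?thesis
    unfolding Lt_ring_def rupture_def
    using ideal.quotient_is_cring[OF cring.cgenideal_ideal] L_root_poly_closed
    by (simp flip: L_poly_def)
qed

lemma t_root_closed: "\<tau> \<in> carrier Lt"
  unfolding t_root_def
  using ring_hom_memE(1)[OF ring_hom_ring.homh[OF Lt_class_hom]] L.var_closed(1)[OF L.carrier_is_subring]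
  by (simp add: L_poly_def)

lemma t_root_power: "\<tau> [^]\<^bsub>Lt\<^esub> p = Lt_embed E p (cls tp)"
proof -
  interpret UP: domain "L_poly E"
    unfolding L_poly_def by (rule L.univ_poly_is_domain[OF L.carrier_is_subring])
  interpret h: ring_hom_ring "L_poly E" Lt "Lt_class E p"
    by (rule Lt_class_hom)
  have X: "X\<^bsub>L\<^esub> \<in> carrier (L_poly E)"
    unfolding L_poly_def by (rule L.var_closed(1)[OF L.carrier_is_subring])
  have c: "L.poly_of_const (cls tp) \<in> carrier (L_poly E)"
    using ring_hom_memE(1)[OF L.canonical_embedding_is_hom[OF L.carrier_is_subring]]
    by (simp add: L_poly_def)
  have "Lt_class E p (L_root_poly E p) = \<zero>\<^bsub>Lt\<^esub>"
    using UP.a_rcos_zero[OF UP.cgenideal_ideal[OF L_root_poly_closed]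
        UP.cgenideal_self[OF L_root_poly_closed]]
    by (simp add: Lt_class_def Lt_ring_def rupture_def FactRing_def L_poly_def)
  then have "\<tau> [^]\<^bsub>Lt\<^esub> p \<ominus>\<^bsub>Lt\<^esub> Lt_embed E p (cls tp) = \<zero>\<^bsub>Lt\<^esub>"
    using X c unfolding L_root_poly_def
    by (simp add: a_minus_def t_root_def Lt_embed_def h.hom_nat_pow L_class_eq)
  then show ?thesis
    using emb.S.minus_eq emb.S.r_right_minus_eq t_root_closed by simp
qed

sublocale ext: poly_type_hom_root Lt "\<lambda>G. Lt_embed E p (cls G)" \<tau> p tp
proof -
  interpret Lt: cring Lt
    by (rule cring_Lt)
  show "poly_type_hom_root Lt (\<lambda>G. Lt_embed E p (cls G)) \<tau> p tp"
    by unfold_locales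
      (simp_all add: cls_add cls_mult cls_1 t_root_closed t_root_power p_pos)
qed

lemma range_ext: "range ext.\<Phi> = carrier Lt"
proof
  show "carrier Lt \<subseteq> range ext.\<Phi>"
  proof
    fix w assume "w \<in> carrier Lt"
    then obtain q where q: "q \<in> carrier (L_poly E)" "w = Lt_class E p q"
      by (auto simp: Lt_ring_def rupture_def FactRing_def A_RCOSETS_def' Lt_class_def L_poly_def)
    interpret UP: domain "L_poly E"
      unfolding L_poly_def by (rule L.univ_poly_is_domain[OF L.carrier_is_subring])
    interpret h: ring_hom_ring "L_poly E" Lt "Lt_class E p"
      by (rule Lt_class_hom)
    have X: "X\<^bsub>L\<^esub> \<in> carrier (L_poly E)"
      unfolding L_poly_def by (rule L.var_closed(1)[OF L.carrier_is_subring])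
    have set_q: "set q \<subseteq> carrier L"
      using q(1) by (auto simp: L_poly_def polynomial_def simp flip: univ_poly_carrier)
    have coeffs: "set (map L.poly_of_const q) \<subseteq> carrier (L_poly E)"
      using set_q ring_hom_memE(1)[OF L.canonical_embedding_is_hom[OF L.carrier_is_subring]]
      by (auto simp: L_poly_def)
    \<comment> \<open>A polynomial is its own value at \<open>X\<close>; the quotient map turns this
      into a value at \<open>\<tau>\<close>.\<close>
    have "q = UP.eval (map L.poly_of_const q) X\<^bsub>L\<^esub>"
      using L.eval_rewrite[OF L.carrier_is_subring q(1)[unfolded L_poly_def]] by (simp add: L_poly_def)
    then have "w = emb.S.eval (map (Lt_class E p) (map L.poly_of_const q)) \<tau>"
      using h.eval_hom'[OF X coeffs] by (simp add: q(2) t_root_def)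
    moreover have "set (map (Lt_class E p) (map L.poly_of_const q)) \<subseteq> range (\<lambda>G. Lt_embed E p (cls G))"
      using set_q by (auto simp: Lt_embed_def carrier_L)
    ultimately show "w \<in> range ext.\<Phi>"
      using ext.eval_in_range_\<Phi> by simp
  qed
qed auto

section \<open>Frobenius and coordinates\<close>

text \<open>Coordinates are given by representatives in \<open>k(t)[y]\<close>, so that
  \<open>p\<close>-th powers can be computed there.\<close>

definition comb :: "(nat \<Rightarrow> 'k poly fract poly) \<Rightarrow> 'k poly fract poly set list set" where
  "comb a = ext.\<Phi> (\<Sum>i<p. Polynomial.monom (a i) i)"

lemma comb_closed [simp]: "comb a \<in> carrier Lt"
  by (simp add: comb_def)

lemma comb_eq_finsum:
  "comb a = (\<Oplus>\<^bsub>Lt\<^esub>i\<in>{..<p}. (\<tau> [^]\<^bsub>Lt\<^esub> i) \<otimes>\<^bsub>Lt\<^esub> Lt_embed E p (cls (a i)))"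
  by (simp add: comb_def ext.\<Phi>_sum_monom)

lemma combE:
  assumes "w \<in> carrier Lt"
  obtains a where "w = comb a"
proof -
  obtain W where W: "w = ext.\<Phi> W"
    using assms range_ext by blast
  obtain V where V: "\<And>i. i \<ge> p \<Longrightarrow> Polynomial.coeff V i = 0" "ext.\<Phi> V = ext.\<Phi> W"
    using ext.\<Phi>_reduce[of W] by blast
  have "V = (\<Sum>i<p. Polynomial.monom (Polynomial.coeff V i) i)"
    using V(1) by (intro poly_eqI) (auto simp: coeff_sum not_less)
  then have "w = comb (Polynomial.coeff V)"
    using V(2) W by (simp add: comb_def)
  then show thesis
    by (rule that)
qed

lemma CHAR_kt_y: "CHAR('k poly fract poly) = p"
proof -
  have "(of_nat p :: 'k poly fract) = to_fract (of_nat p)"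
    by (induction p) simp_all
  also have "\<dots> = 0"
    using char by (simp add: of_nat_eq_0_iff_char_dvd)
  finally have "CHAR('k poly fract) dvd p"
    by (simp only: of_nat_eq_0_iff_char_dvd)
  then show ?thesis
    using prime_p by (auto simp: prime_nat_iff)
qed

lemma comb_power: "comb a [^]\<^bsub>Lt\<^esub> p = Lt_embed E p (cls (\<Sum>i<p. tp ^ i * a i ^ p))"
  unfolding comb_def by (rule ext.\<Phi>_power_p[OF prime_p CHAR_kt_y])

lemma tp_power: "tp ^ i = fract_poly [:Polynomial.monom 1 i:]"
proof (induction i)
  case (Suc i)
  have "[:Polynomial.monom 1 (Suc i):] = [:[:0, 1:]:] * [:Polynomial.monom (1 :: 'k) i:]"
    by (simp add: monom_Suc)
  then show ?case
    by (simp only: fract_poly_mult power_Suc Suc)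
qed (simp add: map_poly_pCons flip: one_pCons)

text \<open>By the freshman's dream the difference of the two sums is
  \<open>\<Sum>i<p. tp ^ i * (a i - b i) ^ p\<close>, to which independence applies. Both
  injectivity of Frobenius and uniqueness of coordinates rest on this.\<close>

lemma cls_sum_power_eqD:
  assumes "cls (\<Sum>i<p. tp ^ i * a i ^ p) = cls (\<Sum>i<p. tp ^ i * b i ^ p)" and "i < p"
  shows "cls (a i) = cls (b i)"
proof -
  have frob: "(a i - b i) ^ p + b i ^ p = a i ^ p" for i
  proof -
    have "((a i - b i) + b i) ^ p = (a i - b i) ^ p + b i ^ p"
      by (rule freshmans_dream) (simp_all only: CHAR_kt_y prime_p)
    then show ?thesis
      by simp
  qed
  have "(\<Sum>i<p. tp ^ i * (a i - b i) ^ p) + (\<Sum>i<p. tp ^ i * b i ^ p) = (\<Sum>i<p. tp ^ i * a i ^ p)"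
    unfolding sum.distrib[symmetric] distrib_left[symmetric] frob ..
  from arg_cong[OF this, of "fls_eval f"]
  have "fls_eval f (\<Sum>i<p. tp ^ i * (a i - b i) ^ p) = 0"
    using assms(1) by (simp add: cls_eq_iff fls_eval_add)
  then have "fract_poly E dvd a i - b i"
    using irreducible_dvd_sum_t_power[OF irr root _ \<open>i < p\<close>, of "\<lambda>i. a i - b i"]
    unfolding fls_eval_eq_0_iff[OF irr root] tp_power by blast
  then show ?thesis
    using fls_eval_add[of f "a i - b i" "b i"]
    by (simp add: cls_eq_iff flip: fls_eval_eq_0_iff[OF irr root])
qed

lemma comb_power_eqD:
  assumes "comb a [^]\<^bsub>Lt\<^esub> p = comb b [^]\<^bsub>Lt\<^esub> p" and "i < p"
  shows "cls (a i) = cls (b i)"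
  using inj_onD[OF inj_Lt_embed assms(1)[unfolded comb_power] cls_closed cls_closed] assms(2)
  by (rule cls_sum_power_eqD)

lemma frob_comb: "frob E p (comb a) = cls (\<Sum>i<p. tp ^ i * a i ^ p)"
  unfolding frob_def comb_power
  by (rule the_equality) (auto dest: inj_onD[OF inj_Lt_embed])

lemma comb_cong: "(\<And>i. i < p \<Longrightarrow> cls (a i) = cls (b i)) \<Longrightarrow> comb a = comb b"
  unfolding comb_eq_finsum by (rule emb.S.finsum_cong') auto

lemma inj_frob: "inj_on (frob E p) (carrier Lt)"
proof (rule inj_onI)
  fix w w' assume w: "w \<in> carrier Lt" "w' \<in> carrier Lt" and eq: "frob E p w = frob E p w'"
  obtain a where a: "w = comb a"
    using w(1) by (rule combE)
  obtain b where b: "w' = comb b"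
    using w(2) by (rule combE)
  show "w = w'"
    unfolding a b by (rule comb_cong, rule cls_sum_power_eqD[OF eq[unfolded a b frob_comb]])
qed

text \<open>Two coordinate families of one element have the same \<open>p\<close>-th power, hence
  agree below \<open>p\<close>; outside, extensionality fixes them.\<close>

lemma t_root_coords_comb: "t_root_coords E p (comb a) = (\<lambda>i\<in>{..<p}. cls (a i))"
  unfolding t_root_coords_def
proof (rule the_equality)
  have "comb a = (\<Oplus>\<^bsub>Lt\<^esub>i\<in>{..<p}. \<tau> [^]\<^bsub>Lt\<^esub> i \<otimes>\<^bsub>Lt\<^esub> Lt_embed E p ((\<lambda>i\<in>{..<p}. cls (a i)) i))"
    unfolding comb_eq_finsum by (rule emb.S.finsum_cong') (auto simp: t_root_closed)
  then show "(\<lambda>i\<in>{..<p}. cls (a i)) \<in> {..<p} \<rightarrow>\<^sub>E carrier L \<and>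
      comb a = (\<Oplus>\<^bsub>Lt\<^esub>i\<in>{..<p}. \<tau> [^]\<^bsub>Lt\<^esub> i \<otimes>\<^bsub>Lt\<^esub> Lt_embed E p ((\<lambda>i\<in>{..<p}. cls (a i)) i))"
    by auto
next
  fix c assume c: "c \<in> {..<p} \<rightarrow>\<^sub>E carrier L \<and>
      comb a = (\<Oplus>\<^bsub>Lt\<^esub>i\<in>{..<p}. \<tau> [^]\<^bsub>Lt\<^esub> i \<otimes>\<^bsub>Lt\<^esub> Lt_embed E p (c i))"
  then have "\<forall>i\<in>{..<p}. \<exists>G. c i = cls G"
    unfolding carrier_L by blast
  then obtain b where b: "\<And>i. i < p \<Longrightarrow> c i = cls (b i)"
    by (metis lessThan_iff)
  have "comb b = (\<Oplus>\<^bsub>Lt\<^esub>i\<in>{..<p}. \<tau> [^]\<^bsub>Lt\<^esub> i \<otimes>\<^bsub>Lt\<^esub> Lt_embed E p (c i))"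
    unfolding comb_eq_finsum by (rule emb.S.finsum_cong') (auto simp: b t_root_closed)
  then have "comb a = comb b"
    using c by simp
  then show "c = (\<lambda>i\<in>{..<p}. cls (a i))"
    using comb_power_eqD[of a b] c by (intro ext) (auto simp: PiE_def extensional_def b)
qed

text \<open>Sections can be read off from any such expansion of an element of
  \<open>L\<close>.\<close>

lemma section_op_sum_power:
  assumes "r < p"
  shows "section_op E p r (cls (\<Sum>i<p. tp ^ i * a i ^ p)) = cls (a r)"
proof -
  have "frob_inv E p (cls (\<Sum>i<p. tp ^ i * a i ^ p)) = comb a"
    unfolding frob_inv_def frob_comb[symmetric] by (rule inv_into_f_f[OF inj_frob comb_closed])
  then show ?thesis
    using assms by (simp add: section_op_def t_root_coords_comb)
qed

end

section \<open>Sections of \<open>P / E_y\<close> and uniqueness of the numerator\<close>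

text \<open>
  In \<open>L\<close>, which \<open>fls_eval\<close> embeds in the Laurent series, \<open>P / E\<^sub>y = \<Sum>\<^sub>r t\<^sup>r (Q\<^sub>r / E\<^sub>y)\<^sup>p\<close> is the
  congruence of \<open>dvd_sum_bipoly_section_power\<close> divided by \<open>E\<^sub>y\<^sup>p\<close>.
\<close>

theorem (in rooted_irreducible_char_p) section_op_L_over_Ey:
  assumes perf: "surj (\<lambda>x::'k. x ^ p)" and Ey: "eval_y (pderiv E) f \<noteq> 0" and r: "r < p"
  shows "section_op E p r (L_over_Ey E P) =
    L_over_Ey E (bipoly_section r (p - 1) (P * E ^ (p - 1)))"
proof -
  let ?Q = "\<lambda>r. bipoly_section r (p - 1) (P * E ^ (p - 1))"
  let ?ev = "\<lambda>P. fls_eval f (fract_poly P)"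
  have "?ev (pderiv E) \<noteq> 0"
    using Ey by (simp add: fls_eval_fract_poly)
  \<comment> \<open>\<open>U\<close> represents the inverse of \<open>E_y\<close> in
    \<open>L\<close>.\<close>
  then obtain U where U: "fls_eval f U * ?ev (pderiv E) = 1"
    by (rule ex_inverse_mod)
  let ?A = "P * pderiv E ^ (p - 1)" and ?B = "\<Sum>r<p. [:Polynomial.monom 1 r:] * ?Q r ^ p"
  have "E dvd ?A - ?B"
    using dvd_sum_bipoly_section_power[where 'a = 'k, of E P] perf p_pos unfolding char by blast
  from fract_poly_dvd[OF this] have 0: "?ev (?A - ?B) = 0"
    unfolding fls_eval_eq_0_iff[OF irr root] .
  have "?ev (?A - ?B) + ?ev ?B = ?ev ?A"
    unfolding fls_eval_add[symmetric] fract_poly_add[symmetric] diff_add_cancel ..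
  then have "?ev ?B = ?ev ?A"
    unfolding 0 add_0_left .
  moreover have "fract_poly (A ^ n) = fract_poly A ^ n" for A :: "'k poly poly" and n
    by (induction n) simp_all
  moreover have "fract_poly (\<Sum>r<n. A r) = (\<Sum>r<n. fract_poly (A r))" for A :: "nat \<Rightarrow> 'k poly poly" and n
    by (induction n) simp_all
  ultimately have key: "(\<Sum>r<p. fls_eval f (tp ^ r) * ?ev (?Q r) ^ p) = ?ev P * ?ev (pderiv E) ^ (p - 1)"
    by (simp only: fls_eval_sum fls_eval_mult fls_eval_power tp_power fract_poly_mult)
  have "fls_eval f (\<Sum>r<p. tp ^ r * (fract_poly (?Q r) * U) ^ p) =
      (\<Sum>r<p. fls_eval f (tp ^ r) * ?ev (?Q r) ^ p) * fls_eval f U ^ p"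
    by (simp only: fls_eval_sum fls_eval_mult fls_eval_power power_mult_distrib sum_distrib_right
        mult.assoc)
  \<comment> \<open>Of the \<open>p\<close> factors \<open>U\<close>, all but one cancel against
    \<open>E_y^(p-1)\<close>; the remaining one makes \<open>P / E_y\<close>.\<close>
  also have "\<dots> = ?ev P * (?ev (pderiv E) ^ (p - 1) * fls_eval f U ^ Suc (p - 1))"
    using p_pos by (simp only: key Suc_diff_1 mult.assoc)
  also have "\<dots> = ?ev P * (fls_eval f U * (fls_eval f U * ?ev (pderiv E)) ^ (p - 1))"
    by (simp only: power_Suc power_mult_distrib mult_ac)
  also have "\<dots> = fls_eval f (fract_poly P * U)"
    by (simp add: U fls_eval_mult)
  finally have "L_over_Ey E P = cls (\<Sum>r<p. tp ^ r * (fract_poly (?Q r) * U) ^ p)"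
    by (simp only: L_over_Ey_eq[OF U] cls_eq_iff)
  then show ?thesis
    using section_op_sum_power[OF r] by (simp only: L_over_Ey_eq[OF U])
qed

text \<open>After cancelling \<open>E_y\<close>, the polynomial \<open>E\<close> divides
  \<open>Q - Q'\<close>, whose degree in \<open>y\<close> is too small unless it is zero.\<close>

lemma (in rooted_irreducible) L_over_Ey_inj:
  assumes Ey: "eval_y (pderiv E) f \<noteq> 0"
    and deg: "deg_y_less Q (Polynomial.degree E)" "deg_y_less Q' (Polynomial.degree E)"
    and eq: "L_over_Ey E Q = L_over_Ey E Q'"
  shows "Q = Q'"
proof -
  have "fls_eval f (fract_poly (pderiv E)) \<noteq> 0"
    using Ey by (simp add: fls_eval_fract_poly)
  then obtain U where U: "fls_eval f U * fls_eval f (fract_poly (pderiv E)) = 1"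
    by (rule ex_inverse_mod)
  then have "fls_eval f U \<noteq> 0"
    by auto
  with eq have "fls_eval f (fract_poly Q) = fls_eval f (fract_poly Q')"
    by (simp add: L_over_Ey_eq[OF U] cls_eq_iff fls_eval_mult)
  moreover have "fls_eval f (fract_poly (Q - Q')) + fls_eval f (fract_poly Q') = fls_eval f (fract_poly Q)"
    by (simp flip: fls_eval_add fract_poly_add)
  ultimately have dvd: "fract_poly E dvd fract_poly (Q - Q')"
    by (simp flip: fls_eval_eq_0_iff[OF irr root])
  have "deg_y_less (Q - Q') (Polynomial.degree E)"
    using deg by (simp add: deg_y_less_iff)
  moreover have degree: "Polynomial.degree (fract_poly P) = Polynomial.degree P" for P :: "'k poly poly"
    by (rule degree_map_poly) simp
  ultimately show ?thesis
    using dvd_imp_degree_le[OF dvd] unfolding deg_y_less_def degree fract_poly_eq_0_iff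
    by (cases "Q = Q'") auto
qed

theorem theorem2:
  fixes p d h :: nat and E :: "'k::field poly poly" and f :: "'k fps"
  assumes "CHAR('k) = p" and "p > 0"
    and "perfect_field TYPE('k)"
    and "Factorial_Ring.irreducible (fract_poly E)"
    and "separable_poly (fract_poly E)"
    and "d = Polynomial.degree E" and "d \<ge> 1"
    and "h = deg_t E"
    and "eval_y E f = 0"
    and "eval_y (pderiv E) f \<noteq> 0"
  shows "\<forall>P r. deg_t_less P h \<and> deg_y_less P d \<and> r < p \<longrightarrow>
    (\<exists>!Q. deg_t_less Q h \<and> deg_y_less Q d \<and>
          section_op E p r (L_over_Ey E P) = L_over_Ey E Q)"
proof (intro allI impI)
  fix P :: "'k poly poly" and r assume P: "deg_t_less P h \<and> deg_y_less P d \<and> r < p"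
  interpret rooted_irreducible_char_p E f p
    using assms by unfold_locales auto
  \<comment> \<open>\<open>p > 0\<close> rules out the characteristic zero case of
    \<open>perfect_field\<close>.\<close>
  have surj: "surj (\<lambda>x::'k. x ^ p)"
    using assms(1-3) by (simp add: perfect_field_def)
  let ?Q = "bipoly_section r (p - 1) (P * E ^ (p - 1))"
  \<comment> \<open>The bounds for \<open>P * E ^ (p - 1)\<close> carry the factor
    \<open>Suc (p - 1)\<close>, which the sections divide out.\<close>
  have Suc_p: "Suc (p - 1) = CHAR('k)"
    using assms(1,2) by simp
  have "deg_t_less ?Q h" "deg_y_less ?Q d"
    using P deg_t_less_bipoly_section deg_t_less_mult_power[of P E "p - 1"]
      deg_y_less_bipoly_section deg_y_less_mult_power[of P E "p - 1"] assms(1,2)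
    unfolding assms(6,8) Suc_p by blast+
  moreover have S: "section_op E p r (L_over_Ey E P) = L_over_Ey E ?Q"
    using section_op_L_over_Ey[OF surj assms(10)] P by blast
  ultimately show "\<exists>!Q. deg_t_less Q h \<and> deg_y_less Q d \<and>
      section_op E p r (L_over_Ey E P) = L_over_Ey E Q"
    using L_over_Ey_inj[OF assms(10)] unfolding assms(6) by metis
qed

end
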